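(* Assume $P\in[0,1)$ and $\lim_{x\uparrow 1/P}F(x)=\infty$. Let $s\ge1$ be fixed. (i) The equation $\lambda(1-D_F(s,\lambda))=\varepsilon$ has at least two solutions $\lambda\in(0,\lambda_P)$ when $\varepsilon>0$ is sufficiently small. (ii) The equation $\lambda(1-D_F^R(s,\lambda))=\varepsilon$ has a unique solution $\lambda\in(0,\lambda_P)$ when $\varepsilon\in(0,s)$.
   Context: $s\ge1$ is an integer (number of servers) and $(p_k)_{k\ge s}$ is a sequence in $[0,1]$ (admission policy). Put $F(x)=\sum_{n=0}^{\infty}p_s\cdots p_{s+n}\,x^{n+1}$ and $P=\limsup_{n\to\infty}(p_s\cdots p_{s+n})^{1/(n+1)}\in[0,1]$, so that the radius of convergence of $F$ is $1/P$ ($=\infty$ if $P=0$), and $\lambda_P=s/P$ ($=\infty$ if $P=0$). The Erlang B function is $B(s,\lambda)=\dfrac{\lambda^s/s!}{\sum_{k=0}^s\lambda^k/k!}$. For $0<\lambda<\lambda_P$ define $$D_F(s,\lambda)=\frac{1+F(\lambda/s)}{B(s,\lambda)^{-1}+F(\lambda/s)},\qquad D_F^R(s,\lambda)=\frac{1+(1-s/\lambda)F(\lambda/s)}{B(s,\lambda)^{-1}+F(\lambda/s)}.$$ (These are the stationary probabilities that an arriving customer finds all servers occupied, respectively is rejected, in the birth-death queue with birth rates $\lambda$ for $k<s$ and $\lambda p_k$ for $k\ge s$, and death rates $\min(k,s)$.) *)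

theory Defs
  imports "HOL-Analysis.Analysis"
begin

definition adm_prod :: "nat \<Rightarrow> (nat \<Rightarrow> real) \<Rightarrow> nat \<Rightarrow> real"
  where "adm_prod s p n = (\<Prod>k=s..s+n. p k)"

definition adm_F :: "nat \<Rightarrow> (nat \<Rightarrow> real) \<Rightarrow> real \<Rightarrow> real"
  where "adm_F s p x = (\<Sum>n. adm_prod s p n * x ^ (n + 1))"

definition adm_P :: "nat \<Rightarrow> (nat \<Rightarrow> real) \<Rightarrow> ereal"
  where "adm_P s p = limsup (\<lambda>n. ereal (root (n + 1) (adm_prod s p n)))"

text \<open>In the extended reals \<open>inverse 0 = \<infinity>\<close>, so for \<open>s \<ge> 1\<close> the quotient below is
  \<open>\<infinity>\<close> when \<open>adm_P s p = 0\<close>.\<close>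

definition lambda_P :: "nat \<Rightarrow> (nat \<Rightarrow> real) \<Rightarrow> ereal"
  where "lambda_P s p = ereal (real s) / adm_P s p"

text \<open>The filter of \<open>x\<close> increasing to \<open>1 / P\<close>, where \<open>1 / 0 = \<infinity>\<close>.\<close>

definition to_radius :: "nat \<Rightarrow> (nat \<Rightarrow> real) \<Rightarrow> real filter"
  where "to_radius s p =
    (if adm_P s p = 0 then at_top else at_left (1 / real_of_ereal (adm_P s p)))"

definition erlang_B :: "nat \<Rightarrow> real \<Rightarrow> real"
  where "erlang_B s l = (l ^ s / fact s) / (\<Sum>k=0..s. l ^ k / fact k)"

definition D_F :: "nat \<Rightarrow> (nat \<Rightarrow> real) \<Rightarrow> real \<Rightarrow> real"
  where "D_F s p l =
    (1 + adm_F s p (l / real s)) / (inverse (erlang_B s l) + adm_F s p (l / real s))"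

definition D_F_R :: "nat \<Rightarrow> (nat \<Rightarrow> real) \<Rightarrow> real \<Rightarrow> real"
  where "D_F_R s p l =
    (1 + (1 - real s / l) * adm_F s p (l / real s))
      / (inverse (erlang_B s l) + adm_F s p (l / real s))"

end

theory Submission
  imports Defs
begin

text \<open>
  Multiply every probability by the common factor that makes state \<open>k < s\<close> have weight
  \<open>l ^ k / fact k\<close>. Let \<open>A\<close> be the total weight of the states with a free server, and let
  \<open>T = u * (1 + F (l / s))\<close> with \<open>u = l ^ s / fact s\<close> be that of the other states. Then
  \<open>l * (1 - D_F) = l * A / (A + T)\<close> and \<open>l * (1 - D_F_R) = (l * A + s * u * F) / (A + T)\<close>,
  and the second quantity is the mean number of occupied servers
  (\<open>throughput_D_F\<close>, \<open>throughput_D_F_R\<close>, \<open>throughput_D_F_R_eq_mean_occupied\<close>).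

  Since \<open>F\<close> diverges at \<open>1 / P\<close> while \<open>l * A / u\<close> stays bounded for \<open>l \<ge> 1\<close>, the first
  quantity is continuous, positive, and comes arbitrarily close to zero at both ends of the
  interval. Hence it takes every small value once before and once after \<open>l = s\<close>, which lies in
  the interval because \<open>P < 1\<close>. The second quantity is continuous and runs from \<open>0\<close> to \<open>s\<close>,
  so it takes every value in between.

  Uniqueness follows from strict monotonicity of the mean number of occupied servers
  (\<open>mean_occupied_strict_mono\<close>): raising the arrival rate multiplies the weight of state \<open>k\<close> by
  the \<open>k\<close>-th power of a fixed ratio \<open>r > 1\<close>, which shifts mass to larger \<open>k\<close>.\<close>

section \<open>The generating series inside its disc of convergence\<close>

lemma adm_prod_nonneg:
  assumes "\<And>k. k \<ge> s \<Longrightarrow> p k \<in> {0..1::real}"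
  shows "0 \<le> adm_prod s p n"
  unfolding adm_prod_def by (rule prod_nonneg) (use assms in auto)

text \<open>
  In \<open>F\<close> the coefficient \<open>adm_prod s p n\<close> belongs to the power \<open>n + 1\<close>, and accordingly \<open>adm_P\<close>
  takes roots of order \<open>n + 1\<close>. Shifting the index turns \<open>adm_P\<close> into the limit superior of the
  Cauchy-Hadamard formula.\<close>

lemma conv_radius_adm:
  assumes p: "\<And>k. k \<ge> s \<Longrightarrow> p k \<in> {0..1::real}"
  defines "c \<equiv> \<lambda>n. case n of 0 \<Rightarrow> 0 | Suc m \<Rightarrow> adm_prod s p m"
  shows "conv_radius c = inverse (adm_P s p)"
proof -
  have "limsup (\<lambda>n. ereal (root n (norm (c n))))
      = limsup (\<lambda>n. ereal (root (n + 1) (norm (c (n + 1)))))"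
    using limsup_shift[of "\<lambda>n. ereal (root n (norm (c n)))"] by simp
  also have "\<dots> = adm_P s p"
    using adm_prod_nonneg[of s p] p by (simp add: adm_P_def c_def)
  finally show ?thesis by (simp add: conv_radius_def)
qed

lemma adm_series:
  assumes p: "\<And>k. k \<ge> s \<Longrightarrow> p k \<in> {0..1::real}"
    and x: "0 \<le> x" "ereal x < inverse (adm_P s p)"
  shows summable_adm_F: "summable (\<lambda>n. adm_prod s p n * x ^ (n + 1))"
    and isCont_adm_F: "isCont (adm_F s p) x"
proof -
  define c where "c = (\<lambda>n. case n of 0 \<Rightarrow> 0 | Suc m \<Rightarrow> adm_prod s p m)"
  have R: "conv_radius c = inverse (adm_P s p)"
    unfolding c_def by (rule conv_radius_adm[OF p])
  have powser: "summable (\<lambda>n. adm_prod s p n * y ^ (n + 1))"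
      "adm_F s p y = (\<Sum>n. c n * y ^ n)"
    if "ereal (norm y) < conv_radius c" for y
  proof -
    have sm: "summable (\<lambda>n. c n * y ^ n)"
      using that by (rule summable_in_conv_radius)
    show "summable (\<lambda>n. adm_prod s p n * y ^ (n + 1))"
      using sm summable_Suc_iff[of "\<lambda>n. c n * y ^ n"] by (simp add: c_def)
    show "adm_F s p y = (\<Sum>n. c n * y ^ n)"
      using suminf_split_head[OF sm] by (simp add: c_def adm_F_def)
  qed
  show "summable (\<lambda>n. adm_prod s p n * x ^ (n + 1))"
    using powser(1)[of x] x R by simp
  obtain y where y: "x < y" "ereal y < conv_radius c"
    using ereal_dense2[of "ereal x" "conv_radius c"] x R by auto
  have "isCont (\<lambda>x. \<Sum>n. c n * x ^ n) x"
    using y x(1) by (intro isCont_powser[of _ y] summable_in_conv_radius) auto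
  moreover have "\<forall>\<^sub>F z in nhds x. (\<Sum>n. c n * z ^ n) = adm_F s p z"
  proof -
    have "z \<in> {-y<..<y} \<Longrightarrow> ereal (norm z) < conv_radius c" for z
      using y by (auto intro: le_less_trans[of _ "ereal y"])
    moreover have "\<forall>\<^sub>F z in nhds x. z \<in> {-y<..<y}"
      using y x by (intro eventually_nhds_in_open) auto
    ultimately show ?thesis
      by (auto elim!: eventually_mono simp: powser(2))
  qed
  ultimately show "isCont (adm_F s p) x"
    using isCont_cong[of "\<lambda>z. \<Sum>n. c n * z ^ n" "adm_F s p" x] by simp
qed

lemma adm_F_nonneg:
  assumes "\<And>k. k \<ge> s \<Longrightarrow> p k \<in> {0..1::real}" "0 \<le> x" "ereal x < inverse (adm_P s p)"
  shows "0 \<le> adm_F s p x"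
  unfolding adm_F_def
  using assms by (intro suminf_nonneg summable_adm_F mult_nonneg_nonneg adm_prod_nonneg) auto

lemma adm_F_mono:
  assumes p: "\<And>k. k \<ge> s \<Longrightarrow> p k \<in> {0..1::real}"
    and "0 \<le> x" "x \<le> y" "ereal y < inverse (adm_P s p)"
  shows "adm_F s p x \<le> adm_F s p y"
proof -
  have "ereal x < inverse (adm_P s p)"
    using assms by (meson ereal_less_eq(3) le_less_trans)
  then show ?thesis
    unfolding adm_F_def
    using assms by (intro suminf_le summable_adm_F mult_left_mono power_mono adm_prod_nonneg) auto
qed

lemma less_lambda_P_iff:
  assumes "s \<ge> 1" "0 \<le> adm_P s p" "adm_P s p < 1"
  shows "ereal l < lambda_P s p \<longleftrightarrow> ereal (l / real s) < inverse (adm_P s p)"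
proof -
  obtain r where r: "adm_P s p = ereal r" "0 \<le> r"
    using assms by (cases "adm_P s p") auto
  show ?thesis
    using r assms by (cases "r = 0") (auto simp: lambda_P_def divide_ereal_def field_simps)
qed

text \<open>
  This is the form in which the divergence of \<open>F\<close> is used below. It covers \<open>P = 0\<close> and \<open>P > 0\<close>
  alike, because in both cases the filter is eventually above \<open>1\<close> and below \<open>1 / P\<close>.\<close>

lemma adm_F_unbounded:
  assumes P: "0 \<le> adm_P s p" "adm_P s p < 1"
    and lim: "filterlim (adm_F s p) at_top (to_radius s p)"
  shows "\<exists>x>1. ereal x < inverse (adm_P s p) \<and> adm_F s p x \<ge> M"
proof -
  obtain r where r: "adm_P s p = ereal r" "0 \<le> r" "r < 1"
    using P by (cases "adm_P s p") auto
  have "\<forall>\<^sub>F x in to_radius s p. 1 < x \<and> ereal x < inverse (adm_P s p)"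
  proof (cases "r = 0")
    case True
    then show ?thesis using r eventually_gt_at_top[of "1::real"] by (simp add: to_radius_def)
  next
    case False
    then have "1 < 1 / r" using r by simp
    then have "\<forall>\<^sub>F x in at_left (1 / r). x \<in> {1<..<1 / r}"
      by (intro eventually_at_leftI[of 1]) auto
    then show ?thesis
      using r False by (auto simp: to_radius_def inverse_eq_divide elim!: eventually_mono)
  qed
  moreover have "\<forall>\<^sub>F x in to_radius s p. adm_F s p x \<ge> M"
    using lim by (simp add: filterlim_at_top)
  ultimately have "\<forall>\<^sub>F x in to_radius s p. 1 < x \<and> ereal x < inverse (adm_P s p) \<and> adm_F s p x \<ge> M"
    by eventually_elim auto
  moreover have "to_radius s p \<noteq> bot"
    by (simp add: to_radius_def)
  ultimately show ?thesis
    using eventually_happens' by blast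
qed

section \<open>Stationary weights of the birth-death chain\<close>

text \<open>
  The unnormalised stationary weights are \<open>l ^ k / fact k\<close> for \<open>k < s\<close>; the states with all
  servers occupied enter only through their total weight.\<close>

definition idle_weight :: "nat \<Rightarrow> real \<Rightarrow> real"
  where "idle_weight s l = (\<Sum>k<s. l ^ k / fact k)"

definition full_weight :: "nat \<Rightarrow> (nat \<Rightarrow> real) \<Rightarrow> real \<Rightarrow> real"
  where "full_weight s p l = l ^ s / fact s * (1 + adm_F s p (l / real s))"

lemma idle_weight_ge_1:
  assumes "s \<ge> 1" "0 \<le> l"
  shows "1 \<le> idle_weight s l"
proof -
  have "(\<Sum>k\<in>{0::nat}. l ^ k / fact k) \<le> idle_weight s l"
    unfolding idle_weight_def using assms by (intro sum_mono2) auto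
  then show ?thesis by simp
qed

lemma sum_weighted_idle:
  "(\<Sum>k<s. real k * (l ^ k / fact k)) + real s * (l ^ s / fact s) = l * idle_weight s l"
proof -
  have "(\<Sum>k<s. real k * (l ^ k / fact k)) + real s * (l ^ s / fact s)
      = (\<Sum>k<Suc s. real k * (l ^ k / fact k))"
    by simp
  also have "\<dots> = (\<Sum>k<s. real (Suc k) * (l ^ Suc k / fact (Suc k)))"
    by (subst sum.lessThan_Suc_shift) simp
  also have "\<dots> = (\<Sum>k<s. l * (l ^ k / fact k))"
    by (rule sum.cong[OF refl]) (simp del: of_nat_Suc)
  finally show ?thesis by (simp add: idle_weight_def sum_distrib_left)
qed

lemma inverse_erlang_B:
  "inverse (erlang_B s l) = (idle_weight s l + l ^ s / fact s) / (l ^ s / fact s)"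
  by (simp add: erlang_B_def idle_weight_def atLeast0AtMost flip: lessThan_Suc_atMost)

lemma throughput_D_F:
  assumes "s \<ge> 1" "0 < l" "0 \<le> adm_F s p (l / real s)"
  shows "l * (1 - D_F s p l) = l * idle_weight s l / (idle_weight s l + full_weight s p l)"
proof -
  define u where "u = l ^ s / fact s"
  define A where "A = idle_weight s l"
  define F where "F = adm_F s p (l / real s)"
  have pos: "u > 0" "A > 0" "F \<ge> 0"
    using assms idle_weight_ge_1[of s l] by (auto simp: u_def A_def F_def)
  have ne: "A + u * (1 + F) \<noteq> 0"
    using add_pos_pos[OF pos(2) mult_pos_pos[of u "1 + F"]] pos by simp
  have "D_F s p l = (1 + F) / ((A + u) / u + F)"
    by (simp only: D_F_def inverse_erlang_B u_def A_def F_def)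
  also have "(A + u) / u + F = (A + u * (1 + F)) / u"
    using pos by (simp add: field_simps)
  finally have "1 - D_F s p l = A / (A + u * (1 + F))"
    using pos ne by (simp add: field_simps)
  then show ?thesis by (simp add: full_weight_def u_def A_def F_def)
qed

lemma throughput_D_F_R:
  assumes "s \<ge> 1" "0 < l" "0 \<le> adm_F s p (l / real s)"
  shows "l * (1 - D_F_R s p l)
      = (l * idle_weight s l + real s * (l ^ s / fact s * adm_F s p (l / real s)))
        / (idle_weight s l + full_weight s p l)"
proof -
  define u where "u = l ^ s / fact s"
  define A where "A = idle_weight s l"
  define F where "F = adm_F s p (l / real s)"
  have pos: "u > 0" "A > 0" "F \<ge> 0"
    using assms idle_weight_ge_1[of s l] by (auto simp: u_def A_def F_def)
  have ne: "A + u * (1 + F) \<noteq> 0"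
    using add_pos_pos[OF pos(2) mult_pos_pos[of u "1 + F"]] pos by simp
  have "D_F_R s p l = (1 + (1 - real s / l) * F) / ((A + u) / u + F)"
    by (simp only: D_F_R_def inverse_erlang_B u_def A_def F_def)
  also have "(A + u) / u + F = (A + u * (1 + F)) / u"
    using pos by (simp add: field_simps)
  finally have "D_F_R s p l = u * (1 + (1 - real s / l) * F) / (A + u * (1 + F))"
    by (simp add: mult.commute)
  then have "l * (1 - D_F_R s p l)
      = (l * (A + u * (1 + F)) - u * (l + l * (1 - real s / l) * F)) / (A + u * (1 + F))"
    unfolding diff_divide_distrib nonzero_mult_div_cancel_right[OF ne]
    by (simp add: algebra_simps)
  also have "l * (1 - real s / l) = l - real s"
    using assms(2) by (simp add: algebra_simps)
  also have "l * (A + u * (1 + F)) - u * (l + (l - real s) * F) = l * A + real s * (u * F)"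
    by (simp add: algebra_simps)
  finally show ?thesis by (simp add: full_weight_def u_def A_def F_def)
qed

text \<open>
  In equilibrium the rate of accepted arrivals equals the rate of departures, which is the mean
  number of occupied servers.\<close>

lemma throughput_D_F_R_eq_mean_occupied:
  assumes "s \<ge> 1" "0 < l" "0 \<le> adm_F s p (l / real s)"
  shows "l * (1 - D_F_R s p l)
      = ((\<Sum>k<s. real k * (l ^ k / fact k)) + real s * full_weight s p l)
        / (idle_weight s l + full_weight s p l)"
proof -
  have "(\<Sum>k<s. real k * (l ^ k / fact k)) + real s * full_weight s p l
      = l * idle_weight s l + real s * (l ^ s / fact s * adm_F s p (l / real s))"
    by (simp add: sum_weighted_idle[symmetric] full_weight_def distrib_left)
  then show ?thesis using throughput_D_F_R[OF assms] by simp
qed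

section \<open>The mean number of occupied servers increases with the arrival rate\<close>

text \<open>Both factors change sign at \<open>k = h\<close>, where \<open>h\<close> need not be an integer.\<close>

lemma power_crossing_nonneg:
  fixes r h :: real
  assumes "r \<ge> 1"
  shows "(real k - h) * (r ^ k - r powr h) \<ge> 0"
proof -
  have "r ^ k = r powr real k" using assms by (simp add: powr_realpow)
  then show ?thesis
    using assms powr_mono[of h "real k" r] powr_mono[of "real k" h r]
    by (cases "h \<le> real k") (auto simp: zero_le_mult_iff)
qed

text \<open>
  If \<open>h\<close> is the mean at rate \<open>l\<close>, then the deviations \<open>k - h\<close>, weighted at rate \<open>l\<close>, sum to zero.
  Passing to the rate \<open>m = l * r\<close> multiplies the weight of state \<open>k\<close> by \<open>r ^ k\<close>, which is at most
  \<open>r powr h\<close> where the deviation is negative and at least \<open>r powr h\<close> where it is positive. So the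
  new sum exceeds \<open>r powr h\<close> times the old one, that is, zero. The states with all servers
  occupied share the deviation \<open>s - h\<close>, and only a lower bound for the growth of their total
  weight, from \<open>T\<close> to \<open>U\<close>, enters.\<close>

lemma mean_occupied_strict_mono:
  fixes l m T U :: real
  assumes s: "s \<ge> 1" and lm: "0 < l" "l < m"
    and T: "0 < T" and U: "(m / l) ^ s * T \<le> U"
  shows "((\<Sum>k<s. real k * (l ^ k / fact k)) + real s * T) / (idle_weight s l + T)
       < ((\<Sum>k<s. real k * (m ^ k / fact k)) + real s * U) / (idle_weight s m + U)"
    (is "?h < ?N / ?Z")
proof -
  define h where "h = ?h"
  define r where "r = m / l"
  have r: "r > 1" "m = l * r" using lm by (auto simp: r_def)
  have "0 < r ^ s * T" using r T by simp
  then have Upos: "0 < U" using U by (simp add: r_def)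
  have A: "idle_weight s l \<ge> 1" "idle_weight s m \<ge> 1"
    using s lm by (auto intro: idle_weight_ge_1)
  have centred: "(\<Sum>k<s. (real k - h) * w k) = (\<Sum>k<s. real k * w k) - h * (\<Sum>k<s. w k)" for w
    by (simp add: left_diff_distrib sum_subtractf sum_distrib_left)
  have bal: "(\<Sum>k<s. (real k - h) * (l ^ k / fact k)) + (real s - h) * T = 0"
  proof -
    have "h * (idle_weight s l + T) = (\<Sum>k<s. real k * (l ^ k / fact k)) + real s * T"
      using A T by (simp add: h_def)
    then show ?thesis
      unfolding centred idle_weight_def[symmetric] by (simp add: algebra_simps)
  qed
  have hpos: "h > 0"
    using s T A lm by (auto simp: h_def intro!: divide_pos_pos add_nonneg_pos sum_nonneg)
  have hs: "h \<le> real s"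
  proof -
    have "(\<Sum>k<s. real k * (l ^ k / fact k)) \<le> (\<Sum>k<s. real s * (l ^ k / fact k))"
      using lm by (intro sum_mono mult_right_mono) auto
    then show ?thesis
      using A T by (simp add: h_def idle_weight_def field_simps sum_distrib_left)
  qed
  have "0 = r powr h * ((\<Sum>k<s. (real k - h) * (l ^ k / fact k)) + (real s - h) * T)"
    by (simp only: bal mult_zero_right)
  also have "\<dots> = (\<Sum>k<s. (real k - h) * r powr h * (l ^ k / fact k)) + (real s - h) * r powr h * T"
    by (simp add: distrib_left sum_distrib_left mult_ac)
  also have "\<dots> < (\<Sum>k<s. (real k - h) * r ^ k * (l ^ k / fact k)) + (real s - h) * r ^ s * T"
  proof (rule add_less_le_mono)
    have le: "(real k - h) * r powr h \<le> (real k - h) * r ^ k" for k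
      using power_crossing_nonneg[of r k h] r by (simp add: right_diff_distrib)
    show "(real s - h) * r powr h * T \<le> (real s - h) * r ^ s * T"
      using le T by (intro mult_right_mono) auto
    show "(\<Sum>k<s. (real k - h) * r powr h * (l ^ k / fact k))
        < (\<Sum>k<s. (real k - h) * r ^ k * (l ^ k / fact k))"
    proof (rule sum_strict_mono_ex1)
      show "\<forall>k\<in>{..<s}. (real k - h) * r powr h * (l ^ k / fact k)
          \<le> (real k - h) * r ^ k * (l ^ k / fact k)"
        using le lm by (intro ballI mult_right_mono) auto
      \<comment> \<open>The empty system makes the inequality strict, because \<open>h\<close> is positive.\<close>
      have "1 < r powr h" using r hpos by simp
      then have "(real 0 - h) * r powr h * (l ^ 0 / fact 0) < (real 0 - h) * r ^ 0 * (l ^ 0 / fact 0)"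
        using hpos by simp
      then show "\<exists>k\<in>{..<s}. (real k - h) * r powr h * (l ^ k / fact k)
          < (real k - h) * r ^ k * (l ^ k / fact k)"
        using s by (intro bexI[of _ 0]) auto
    qed simp
  qed
  also have "\<dots> \<le> (\<Sum>k<s. (real k - h) * (m ^ k / fact k)) + (real s - h) * U"
  proof -
    have "(real s - h) * (r ^ s * T) \<le> (real s - h) * U"
      using U hs by (intro mult_left_mono) (auto simp: r_def)
    then show ?thesis by (simp add: r(2) power_mult_distrib mult_ac)
  qed
  also have "\<dots> = ?N - h * ?Z"
    unfolding centred idle_weight_def[symmetric] by (simp add: algebra_simps)
  finally have "h < ?N / ?Z"
    using A Upos by (simp add: field_simps)
  then show ?thesis by (simp add: h_def)
qed

lemma full_weight_growth:
  assumes p: "\<And>k. k \<ge> s \<Longrightarrow> p k \<in> {0..1::real}"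
    and lm: "0 < l" "l \<le> m" and m: "ereal (m / real s) < inverse (adm_P s p)"
  shows "(m / l) ^ s * full_weight s p l \<le> full_weight s p m"
proof -
  have "adm_F s p (l / real s) \<le> adm_F s p (m / real s)"
    using lm by (intro adm_F_mono p m divide_right_mono) auto
  then have "m ^ s / fact s * (1 + adm_F s p (l / real s)) \<le> m ^ s / fact s * (1 + adm_F s p (m / real s))"
    using lm by (intro mult_left_mono) auto
  then show ?thesis
    using lm by (simp add: full_weight_def power_divide)
qed

section \<open>Bounds near both ends of the interval\<close>

text \<open>
  A bound with a constant independent of \<open>l\<close>, so that the cases \<open>P = 0\<close> and \<open>P > 0\<close>, where the
  arrival rate tends to infinity or stays bounded, need not be told apart.\<close>

lemma idle_weight_bound:
  assumes "l \<ge> 1"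
  shows "l * idle_weight s l \<le> (\<Sum>k<s. fact s / fact k) * (l ^ s / fact s)"
proof -
  have "l * idle_weight s l = (\<Sum>k<s. l ^ Suc k / fact k)"
    by (simp add: idle_weight_def sum_distrib_left)
  also have "\<dots> \<le> (\<Sum>k<s. l ^ s / fact k)"
    using assms by (intro sum_mono divide_right_mono power_increasing) auto
  also have "\<dots> = (\<Sum>k<s. fact s / fact k) * (l ^ s / fact s)"
    unfolding sum_distrib_right by (intro sum.cong) auto
  finally show ?thesis .
qed

lemma full_weight_ge:
  assumes "0 < l" "0 \<le> adm_F s p (l / real s)"
  shows "l ^ s / fact s \<le> full_weight s p l" "l ^ s / fact s * adm_F s p (l / real s) \<le> full_weight s p l"
  using assms by (auto simp: full_weight_def distrib_left)

lemma throughput_D_F_le: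
  assumes "s \<ge> 1" "0 < l" "0 \<le> adm_F s p (l / real s)"
  shows "l * (1 - D_F s p l) \<le> l"
proof -
  have A: "1 \<le> idle_weight s l" using assms by (intro idle_weight_ge_1) auto
  have u: "0 < l ^ s / fact s" using assms by simp
  have T: "0 < full_weight s p l" using full_weight_ge(1)[OF assms(2,3)] u by linarith
  have "l * idle_weight s l \<le> l * (idle_weight s l + full_weight s p l)"
    using assms T by (intro mult_left_mono) auto
  then show ?thesis
    unfolding throughput_D_F[OF assms] using A T by (subst pos_divide_le_eq) auto
qed

text \<open>
  Discarding \<open>A\<close> from the denominator of \<open>l * A / (A + T)\<close> leaves at least \<open>u * F\<close>, and the
  numerator is at most a constant times \<open>u\<close>; the factor \<open>u\<close> cancels.\<close>

lemma throughput_D_F_end: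
  assumes "s \<ge> 1" "1 \<le> l" "0 < adm_F s p (l / real s)"
  shows "l * (1 - D_F s p l) \<le> (\<Sum>k<s. fact s / fact k) / adm_F s p (l / real s)"
proof -
  define u where "u = l ^ s / fact s"
  define F where "F = adm_F s p (l / real s)"
  define C :: real where "C = (\<Sum>k<s. fact s / fact k)"
  have A: "1 \<le> idle_weight s l" using assms by (intro idle_weight_ge_1) auto
  have u: "0 < u" and F: "0 < F" using assms by (auto simp: u_def F_def)
  have T: "u * F \<le> full_weight s p l"
    using full_weight_ge(2)[of l s p] assms by (simp add: u_def F_def)
  have "l * idle_weight s l / (idle_weight s l + full_weight s p l) \<le> (C * u) / (u * F)"
  proof (rule frac_le)
    show "0 \<le> C * u" using u by (simp add: C_def sum_nonneg)
    show "l * idle_weight s l \<le> C * u"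
      using idle_weight_bound[of l s] assms by (simp add: u_def C_def)
  qed (use A u F T in auto)
  then show ?thesis
    using throughput_D_F[of s l p] u assms by (simp add: C_def F_def)
qed

text \<open>
  For \<open>F\<close> tending to infinity the lower bound tends to \<open>s\<close>, so every value below \<open>s\<close> is
  eventually exceeded.\<close>

lemma throughput_D_F_R_end:
  assumes "s \<ge> 1" "1 \<le> l" "0 < adm_F s p (l / real s)"
  defines "F \<equiv> adm_F s p (l / real s)"
  shows "real s * F / ((\<Sum>k<s. fact s / fact k) + 1 + F) \<le> l * (1 - D_F_R s p l)"
proof -
  define u where "u = l ^ s / fact s"
  define C :: real where "C = (\<Sum>k<s. fact s / fact k)"
  have A: "1 \<le> idle_weight s l" using assms by (intro idle_weight_ge_1) auto
  have u: "0 < u" and F: "0 < F" using assms by (auto simp: u_def F_def)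
  have "1 * idle_weight s l \<le> l * idle_weight s l"
    using assms A by (intro mult_right_mono) auto
  also have "\<dots> \<le> C * u"
    using idle_weight_bound[of l s] assms by (simp add: u_def C_def)
  finally have AC: "idle_weight s l \<le> C * u" by simp
  have T: "full_weight s p l = u * (1 + F)" by (simp add: full_weight_def u_def F_def)
  have "real s * F / (C + 1 + F) = (real s * (u * F)) / (u * (C + 1 + F))"
    using u by simp
  also have "\<dots> \<le> (l * idle_weight s l + real s * (u * F)) / (idle_weight s l + full_weight s p l)"
  proof (rule frac_le)
    show "0 < idle_weight s l + full_weight s p l"
      using A u F unfolding T by (intro add_pos_pos mult_pos_pos) auto
    show "idle_weight s l + full_weight s p l \<le> u * (C + 1 + F)"
      using AC by (simp add: T algebra_simps)
  qed (use A u F assms in auto)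
  finally show ?thesis
    using throughput_D_F_R[of s l p] assms by (simp add: C_def F_def u_def)
qed

lemma throughput_D_F_R_start:
  assumes "s \<ge> 1" "0 < l" "l \<le> 1" "0 \<le> adm_F s p (l / real s)" "adm_F s p (l / real s) \<le> M"
  shows "l * (1 - D_F_R s p l) \<le> l * (1 + real s * M)"
proof -
  define u where "u = l ^ s / fact s"
  define F where "F = adm_F s p (l / real s)"
  define A where "A = idle_weight s l"
  define T where "T = full_weight s p l"
  have A: "1 \<le> A" using assms by (auto simp: A_def intro: idle_weight_ge_1)
  have u: "0 < u" using assms by (simp add: u_def)
  have T: "0 < T"
    using full_weight_ge(1)[OF assms(2,4)] u unfolding T_def u_def by linarith
  have F: "0 \<le> F" "F \<le> M" using assms by (auto simp: F_def)
  have "u \<le> l ^ s" using assms by (simp add: u_def divide_le_eq mult_le_cancel_left1)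
  also have "\<dots> \<le> l" using power_decreasing[of 1 s l] assms by simp
  finally have "u * F \<le> l * M" using F assms by (intro mult_mono) auto
  then have "real s * (u * F) \<le> real s * (l * M)" by (intro mult_left_mono) auto
  also have "\<dots> \<le> real s * (l * M) * (A + T)"
    using A T F assms mult_left_mono[of 1 "A + T" "real s * (l * M)"] by simp
  finally have "l * A + real s * (u * F) \<le> l * (A + T) + real s * (l * M) * (A + T)"
    using mult_nonneg_nonneg[of l T] T assms unfolding distrib_left[of l] by linarith
  then have "(l * A + real s * (u * F)) / (A + T) \<le> l * (1 + real s * M)"
    using A T by (subst pos_divide_le_eq) (auto simp: algebra_simps)
  then show ?thesis
    using throughput_D_F_R[of s l p] assms by (simp add: A_def T_def u_def F_def)
qed

section \<open>Counting the solutions\<close>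

theorem theorem9:
  fixes s :: nat and p :: "nat \<Rightarrow> real"
  assumes s: "s \<ge> 1"
    and p: "\<And>k. k \<ge> s \<Longrightarrow> p k \<in> {0..1}"
    and P: "adm_P s p \<in> {0..<1}"
    and F_lim: "filterlim (adm_F s p) at_top (to_radius s p)"
  shows "(\<exists>\<epsilon>0::real. \<epsilon>0 > 0 \<and> (\<forall>\<epsilon>. 0 < \<epsilon> \<and> \<epsilon> < \<epsilon>0 \<longrightarrow>
            (\<exists>l1 l2 :: real. l1 \<noteq> l2 \<and>
               0 < l1 \<and> ereal l1 < lambda_P s p \<and> l1 * (1 - D_F s p l1) = \<epsilon> \<and>
               0 < l2 \<and> ereal l2 < lambda_P s p \<and> l2 * (1 - D_F s p l2) = \<epsilon>)))
       \<and> (\<forall>\<epsilon>::real. 0 < \<epsilon> \<and> \<epsilon> < real s \<longrightarrow>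
            (\<exists>!l::real. 0 < l \<and> ereal l < lambda_P s p \<and> l * (1 - D_F_R s p l) = \<epsilon>))"
proof -
  define F where "F = (\<lambda>l. adm_F s p (l / real s))"
  define A where "A = idle_weight s"
  define T where "T = full_weight s p"
  define G where "G = (\<lambda>l. l * (1 - D_F s p l))"
  define H where "H = (\<lambda>l. l * (1 - D_F_R s p l))"
  define dom where "dom = (\<lambda>l. 0 < l \<and> ereal l < lambda_P s p)"
  define C :: real where "C = (\<Sum>k<s. fact s / fact k)"
  have P': "0 \<le> adm_P s p" "adm_P s p < 1" using P by auto
  note lt_iff = less_lambda_P_iff[OF s P']
  have dom_le: "dom l" if "0 < l" "l \<le> m" "dom m" for l m
    using that unfolding dom_def by (meson ereal_less_eq(3) le_less_trans)
  have dom_F: "0 \<le> F l" if "dom l" for l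
    using that p unfolding F_def dom_def lt_iff by (intro adm_F_nonneg) auto
  have A_ge: "1 \<le> A l" if "dom l" for l
    using that s unfolding A_def dom_def by (intro idle_weight_ge_1) auto
  have T_pos: "0 < T l" if "dom l" for l
    using that dom_F[OF that] unfolding T_def full_weight_def F_def dom_def
    by (intro mult_pos_pos) auto
  have G_eq: "G l = l * A l / (A l + T l)" if "dom l" for l
    using throughput_D_F[of s l p] that s dom_F[OF that] by (simp add: G_def A_def T_def F_def dom_def)
  have H_eq: "H l = ((\<Sum>k<s. real k * (l ^ k / fact k)) + real s * T l) / (A l + T l)" if "dom l" for l
    using throughput_D_F_R_eq_mean_occupied[of s l p] that s dom_F[OF that] by (simp add: H_def A_def T_def F_def dom_def)
  have cont: "continuous_on {a..b} G" "continuous_on {a..b} H" if "0 < a" "dom b" for a b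
  proof -
    have d: "dom l" if "l \<in> {a..b}" for l
      using that \<open>0 < a\<close> \<open>dom b\<close> dom_le[of l b] by auto
    have "continuous_on {a..b} F"
    proof (rule continuous_at_imp_continuous_on, rule ballI)
      fix l assume "l \<in> {a..b}"
      then have "isCont (adm_F s p) (l / real s)"
        using d[of l] p unfolding dom_def lt_iff by (intro isCont_adm_F) auto
      then show "isCont F l"
        unfolding F_def using s by (intro isCont_o2[of l "\<lambda>l. l / real s" "adm_F s p"]) auto
    qed
    then have TA: "continuous_on {a..b} T" "continuous_on {a..b} A"
      unfolding T_def full_weight_def A_def idle_weight_def F_def
      by (auto intro!: continuous_intros)
    have ne: "A l + T l \<noteq> 0" if "l \<in> {a..b}" for l
      using A_ge[OF d[OF that]] T_pos[OF d[OF that]] by linarith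
    have "continuous_on {a..b} (\<lambda>l. l * A l / (A l + T l))"
      using ne by (intro continuous_intros TA) auto
    then show "continuous_on {a..b} G"
      by (rule continuous_on_eq) (simp add: G_eq d)
    have "continuous_on {a..b}
        (\<lambda>l. ((\<Sum>k<s. real k * (l ^ k / fact k)) + real s * T l) / (A l + T l))"
      using ne by (intro continuous_intros TA) auto
    then show "continuous_on {a..b} H"
      by (rule continuous_on_eq) (simp add: H_eq d)
  qed
  have far: "\<exists>l>real s. dom l \<and> M \<le> F l" for M
  proof -
    obtain x where "x > 1" "ereal x < inverse (adm_P s p)" "adm_F s p x \<ge> M"
      using adm_F_unbounded[OF P' F_lim] by blast
    then show ?thesis
      using s by (intro exI[of _ "real s * x"]) (simp add: dom_def lt_iff F_def)
  qed
  have dom_s: "dom (real s)"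
    using far[of 0] dom_le[of "real s"] s by (metis less_imp_le of_nat_0_less_iff less_le_trans zero_less_one)
  have C: "0 \<le> C" by (simp add: C_def sum_nonneg)

  have "\<exists>l1 l2. l1 \<noteq> l2 \<and> dom l1 \<and> G l1 = \<epsilon> \<and> dom l2 \<and> G l2 = \<epsilon>"
    if e: "0 < \<epsilon>" "\<epsilon> < G (real s)" for \<epsilon>
  proof -
    define a where "a = min \<epsilon> (real s)"
    have a: "0 < a" "a \<le> real s" "a \<le> \<epsilon>" using e s by (auto simp: a_def)
    have da: "dom a" using dom_le[OF a(1,2) dom_s] .
    have "G a \<le> a"
      using throughput_D_F_le[of s a p] s a dom_F[OF da] by (simp add: G_def F_def)
    then obtain l1 where l1: "a \<le> l1" "l1 \<le> real s" "G l1 = \<epsilon>"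
      using IVT'[of G a \<epsilon> "real s"] cont(1)[OF a(1) dom_s] a e by auto
    obtain b where b: "real s < b" "dom b" "C / \<epsilon> + 1 \<le> F b" using far by blast
    have "0 \<le> C / \<epsilon>" using C e by simp
    then have Fb: "0 < F b" "C / \<epsilon> \<le> F b" using b by linarith+
    have "G b \<le> C / F b"
      using throughput_D_F_end[of s b p] s b Fb by (simp add: G_def F_def C_def)
    also have "\<dots> \<le> \<epsilon>" using Fb e by (simp add: field_simps)
    finally obtain l2 where l2: "real s \<le> l2" "l2 \<le> b" "G l2 = \<epsilon>"
      using IVT2'[of G b \<epsilon> "real s"] cont(1)[of "real s" b] b e s by auto
    \<comment> \<open>The two solutions could coincide only at \<open>s\<close>, where \<open>G\<close> exceeds \<open>\<epsilon>\<close>.\<close>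
    have "l1 \<noteq> l2" using l1 l2 e by auto
    moreover have "dom l1" using dom_le[of l1 "real s"] l1 a dom_s by auto
    moreover have "dom l2" using dom_le[of l2 b] l2 b s by auto
    ultimately show ?thesis using l1 l2 by blast
  qed
  moreover have "0 < G (real s)"
    unfolding G_eq[OF dom_s] using A_ge[OF dom_s] T_pos[OF dom_s] s by (intro divide_pos_pos) auto
  moreover have "\<exists>!l. dom l \<and> H l = \<epsilon>" if e: "0 < \<epsilon>" "\<epsilon> < real s" for \<epsilon>
  proof -
    have mono: "H l < H m" if "dom l" "l < m" "dom m" for l m
      unfolding H_eq[OF that(1)] H_eq[OF that(3)] A_def
    proof (rule mean_occupied_strict_mono)
      show "(m / l) ^ s * T l \<le> T m"
        unfolding T_def using that p
        by (intro full_weight_growth) (auto simp: dom_def lt_iff)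
    qed (use s that T_pos in \<open>auto simp: dom_def\<close>)
    define K where "K = 1 + real s * F (real s)"
    have K: "1 \<le> K" using dom_F[OF dom_s] by (simp add: K_def)
    define a where "a = min 1 (\<epsilon> / K)"
    have a: "0 < a" "a \<le> 1" "a \<le> \<epsilon> / K" using e K by (auto simp: a_def)
    have as: "a \<le> real s" using a s by linarith
    have da: "dom a" using dom_le[OF a(1) as dom_s] .
    have "F a \<le> F (real s)"
      unfolding F_def using as a dom_s p
      by (intro adm_F_mono divide_right_mono) (auto simp: dom_def lt_iff)
    then have "H a \<le> a * K"
      using throughput_D_F_R_start[of s a p "F (real s)"] s a dom_F[OF da]
      by (simp add: H_def F_def K_def)
    also have "\<dots> \<le> \<epsilon>" using a K by (simp add: field_simps)
    finally have Ha: "H a \<le> \<epsilon>" .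
    \<comment> \<open>The lower bound for \<open>F b\<close> is \<open>s * F b / (C + 1 + F b) \<ge> \<epsilon>\<close> solved for \<open>F b\<close>.\<close>
    obtain b where b: "real s < b" "dom b" "\<epsilon> * (C + 1) / (real s - \<epsilon>) \<le> F b" using far by blast
    have "0 < \<epsilon> * (C + 1) / (real s - \<epsilon>)"
      using C e by (intro divide_pos_pos mult_pos_pos) auto
    then have Fb: "0 < F b" using b by linarith
    have "\<epsilon> * (C + 1) \<le> F b * (real s - \<epsilon>)"
      using b(3) e by (simp add: pos_divide_le_eq)
    then have "\<epsilon> * (C + 1 + F b) \<le> real s * F b"
      by (simp add: algebra_simps)
    then have "\<epsilon> \<le> real s * F b / (C + 1 + F b)"
      using C Fb by (simp add: pos_le_divide_eq)
    also have "\<dots> \<le> H b"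
      using throughput_D_F_R_end[of s b p] s b Fb by (simp add: H_def F_def C_def)
    finally obtain l where l: "a \<le> l" "l \<le> b" "H l = \<epsilon>"
      using IVT'[of H a \<epsilon> b] cont(2)[OF a(1) b(2)] Ha as b by auto
    have "dom l" using dom_le[of l b] l a b by auto
    moreover have "l' = l" if "dom l'" "H l' = \<epsilon>" for l'
      using mono[of l l'] mono[of l' l] that l \<open>dom l\<close> by (cases l l' rule: linorder_cases) auto
    ultimately show ?thesis
      using l by blast
  qed
  ultimately show ?thesis
    unfolding G_def H_def dom_def by (intro conjI exI[of _ "real s * (1 - D_F s p (real s))"]) (auto simp: conj_assoc)
qed

end
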